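(* If two coarse maps $f,g:X\to Y$ between metric spaces are close and $\mathcal F,\mathcal G$ are asymptotically alike coarse ultrafilters on $X$, then the coarse ultrafilters $f_*\mathcal F$ and $g_*\mathcal G$ on $Y$ are asymptotically alike.
   Context: All metrics take finite values. For a metric space $X$, an entourage is a set $E\subseteq X^2$ with $\sup_{(x,y)\in E}d(x,y)<\infty$; a subset $B\subseteq X$ is bounded if $B^2$ is an entourage; $E[A]$ denotes the set of points of $X$ that are $E$-related to some point of $A$. A map $f:X\to Y$ is coarse if $(f\times f)(E)$ is an entourage for every entourage $E\subseteq X^2$ and $f^{-1}(B)$ is bounded for every bounded $B\subseteq Y$. Two maps $f,g:X\to Y$ are close if $\{(f(x),g(x)):x\in X\}$ is an entourage in $Y$. Subsets $A,B\subseteq X$ are coarsely disjoint, $A\not\curlywedge B$, if $E[A]\cap E[B]$ is bounded for every entourage $E$; otherwise they are close, $A\curlywedge B$. A coarse ultrafilter on $X$ is a system $\mathcal F$ of subsets of $X$ such that (1) $A,B\in\mathcal F$ implies $A\curlywedge B$; (2) if $A,B\subseteq X$ and $A\cup B\in\mathcal F$ then $A\in\mathcal F$ or $B\in\mathcal F$; (3) $X\in\mathcal F$. Two coarse ultrafilters $\mathcal F,\mathcal G$ are asymptotically alike, $\mathcal F\lambda\mathcal G$, if $A\curlywedge B$ for all $A\in\mathcal F$, $B\in\mathcal G$. For a coarse map $f:X\to Y$, $f_*\mathcal F=\{A\subseteq Y:f^{-1}(A)\in\mathcal F\}$, which is a coarse ultrafilter on $Y$. *)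

theory Defs
  imports "HOL-Analysis.Analysis"
begin

text \<open>
  A metric space is a carrier \<open>X\<close> with a distance \<open>d\<close>, to be used under \<^locale>\<open>Metric_space\<close>.
  Every definition depending on a metric space takes both as its first arguments.
\<close>

text \<open>For real-valued \<open>d\<close>, a finite supremum means bounded above; the empty set is an entourage.\<close>

definition entourage :: "'a set \<Rightarrow> ('a \<Rightarrow> 'a \<Rightarrow> real) \<Rightarrow> ('a \<times> 'a) set \<Rightarrow> bool" where
  "entourage X d E \<longleftrightarrow> E \<subseteq> X \<times> X \<and> bdd_above ((\<lambda>(x, y). d x y) ` E)"

definition coarsely_bounded :: "'a set \<Rightarrow> ('a \<Rightarrow> 'a \<Rightarrow> real) \<Rightarrow> 'a set \<Rightarrow> bool" where
  "coarsely_bounded X d B \<longleftrightarrow> B \<subseteq> X \<and> entourage X d (B \<times> B)"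

text \<open>
  The set \<open>E[A]\<close>. This is \<open>E\<inverse> `` A\<close> rather than \<open>E `` A\<close>; since entourages are closed under
  converse, the choice of side makes no difference to the notions below.
\<close>

definition thickening :: "('a \<times> 'a) set \<Rightarrow> 'a set \<Rightarrow> 'a set" where
  "thickening E A = {x. \<exists>a\<in>A. (x, a) \<in> E}"

definition coarse_map ::
  "'a set \<Rightarrow> ('a \<Rightarrow> 'a \<Rightarrow> real) \<Rightarrow> 'b set \<Rightarrow> ('b \<Rightarrow> 'b \<Rightarrow> real) \<Rightarrow> ('a \<Rightarrow> 'b) \<Rightarrow> bool" where
  "coarse_map X dX Y dY f \<longleftrightarrow>
     f \<in> X \<rightarrow> Y \<and>
     (\<forall>E. entourage X dX E \<longrightarrow> entourage Y dY (map_prod f f ` E)) \<and>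
     (\<forall>B. coarsely_bounded Y dY B \<longrightarrow> coarsely_bounded X dX (f -` B \<inter> X))"

definition close_maps ::
  "'a set \<Rightarrow> 'b set \<Rightarrow> ('b \<Rightarrow> 'b \<Rightarrow> real) \<Rightarrow> ('a \<Rightarrow> 'b) \<Rightarrow> ('a \<Rightarrow> 'b) \<Rightarrow> bool" where
  "close_maps X Y dY f g \<longleftrightarrow> entourage Y dY ((\<lambda>x. (f x, g x)) ` X)"

definition coarsely_disjoint ::
  "'a set \<Rightarrow> ('a \<Rightarrow> 'a \<Rightarrow> real) \<Rightarrow> 'a set \<Rightarrow> 'a set \<Rightarrow> bool" where
  "coarsely_disjoint X d A B \<longleftrightarrow>
     (\<forall>E. entourage X d E \<longrightarrow> coarsely_bounded X d (thickening E A \<inter> thickening E B))"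

definition close_sets ::
  "'a set \<Rightarrow> ('a \<Rightarrow> 'a \<Rightarrow> real) \<Rightarrow> 'a set \<Rightarrow> 'a set \<Rightarrow> bool" where
  "close_sets X d A B \<longleftrightarrow> \<not> coarsely_disjoint X d A B"

definition coarse_ultrafilter ::
  "'a set \<Rightarrow> ('a \<Rightarrow> 'a \<Rightarrow> real) \<Rightarrow> 'a set set \<Rightarrow> bool" where
  "coarse_ultrafilter X d F \<longleftrightarrow>
     F \<subseteq> Pow X \<and>
     (\<forall>A B. A \<in> F \<longrightarrow> B \<in> F \<longrightarrow> close_sets X d A B) \<and>
     (\<forall>A B. A \<subseteq> X \<longrightarrow> B \<subseteq> X \<longrightarrow> A \<union> B \<in> F \<longrightarrow> A \<in> F \<or> B \<in> F) \<and>
     X \<in> F"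

definition asymptotically_alike ::
  "'a set \<Rightarrow> ('a \<Rightarrow> 'a \<Rightarrow> real) \<Rightarrow> 'a set set \<Rightarrow> 'a set set \<Rightarrow> bool" where
  "asymptotically_alike X d F G \<longleftrightarrow> (\<forall>A\<in>F. \<forall>B\<in>G. close_sets X d A B)"

definition pushforward :: "'a set \<Rightarrow> 'b set \<Rightarrow> ('a \<Rightarrow> 'b) \<Rightarrow> 'a set set \<Rightarrow> 'b set set" where
  "pushforward X Y f F = {A. A \<subseteq> Y \<and> f -` A \<inter> X \<in> F}"

end

theory Submission
  imports Defs
begin

text \<open>
  If \<open>x\<close> lies within \<open>E\<close> of both \<open>f\<inverse>(A)\<close> and \<open>g\<inverse>(B)\<close>, then \<open>f x\<close> is uniformly close to \<open>A\<close>,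
  and, since \<open>f x\<close> is uniformly close to \<open>g x\<close>, also to \<open>B\<close>. So if \<open>A\<close> and \<open>B\<close> are coarsely
  disjoint, such \<open>x\<close> lie in the \<open>f\<close>-preimage of a bounded set; hence closeness of preimages
  implies closeness of \<open>A\<close> and \<open>B\<close>. The case \<open>f = g\<close> makes push-forwards coarse ultrafilters.
\<close>

lemma entourage_iff:
  "entourage X d E \<longleftrightarrow> E \<subseteq> X \<times> X \<and> (\<exists>C. \<forall>x y. (x, y) \<in> E \<longrightarrow> d x y \<le> C)"
  unfolding entourage_def bdd_above_def ball_simps(9) by (simp add: Ball_def)

lemma entourage_subset: "entourage X d E \<Longrightarrow> D \<subseteq> E \<Longrightarrow> entourage X d D"
  unfolding entourage_iff by blast

lemma entourage_Un:
  assumes "entourage X d D" "entourage X d E"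
  shows "entourage X d (D \<union> E)"
  using assms unfolding entourage_def by (auto simp: image_Un)

text \<open>By the triangle inequality, the sum of the bounds for \<open>D\<close> and
  \<open>E\<close> bounds the composite.\<close>

lemma entourage_relcomp:
  assumes "Metric_space X d" "entourage X d D" "entourage X d E"
  shows "entourage X d (D O E)"
proof -
  interpret Metric_space X d by fact
  obtain C where C: "\<And>x y. (x, y) \<in> D \<Longrightarrow> d x y \<le> C"
    using assms(2) unfolding entourage_iff by blast
  obtain C' where C': "\<And>x y. (x, y) \<in> E \<Longrightarrow> d x y \<le> C'"
    using assms(3) unfolding entourage_iff by blast
  have sub: "D \<subseteq> X \<times> X" "E \<subseteq> X \<times> X"
    using assms(2,3) unfolding entourage_iff by auto
  have "d x z \<le> C + C'" if "(x, y) \<in> D" "(y, z) \<in> E" for x y z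
  proof -
    have "x \<in> X" "y \<in> X" "z \<in> X"
      using that sub by auto
    then have "d x z \<le> d x y + d y z"
      by (rule triangle)
    then show ?thesis
      using C[OF that(1)] C'[OF that(2)] by linarith
  qed
  then show ?thesis
    using sub unfolding entourage_iff by blast
qed

lemma coarsely_bounded_subset:
  assumes "coarsely_bounded X d B" "A \<subseteq> B"
  shows "coarsely_bounded X d A"
  using assms entourage_subset[of X d "B \<times> B" "A \<times> A"]
  unfolding coarsely_bounded_def by blast

text \<open>The bound 0 works because d(y, y) = 0. This allows the comparison of two close maps to
  be applied to a single map.\<close>

lemma close_maps_refl:
  assumes "Metric_space Y d" "f \<in> X \<rightarrow> Y"
  shows "close_maps X Y d f f"
proof -
  interpret Metric_space Y d by fact
  show ?thesis
    using assms(2) unfolding close_maps_def entourage_iff by (auto simp: Pi_iff intro!: exI[of _ 0])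
qed

lemma close_sets_vimage:
  assumes "Metric_space Y dY"
    and f: "coarse_map X dX Y dY f" and g: "coarse_map X dX Y dY g"
    and "close_maps X Y dY f g"
    and close: "close_sets X dX (f -` A \<inter> X) (g -` B \<inter> X)"
  shows "close_sets Y dY A B"
  unfolding close_sets_def
proof
  assume disj: "coarsely_disjoint Y dY A B"
  have "coarsely_bounded X dX (thickening E (f -` A \<inter> X) \<inter> thickening E (g -` B \<inter> X))"
    if E: "entourage X dX E" for E
  proof -
    \<comment> \<open>Coarse disjointness is tested with one entourage on both sides, so
      \<open>H\<close> serves both: its first part relates \<open>f x\<close> to \<open>f a\<close>
      in \<open>A\<close>, its second leads from \<open>f x\<close> through \<open>g x\<close> to
      \<open>g b\<close> in \<open>B\<close>.\<close>
    define H where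
      "H = map_prod f f ` E \<union> (\<lambda>x. (f x, g x)) ` X O map_prod g g ` E"
    have "entourage Y dY (map_prod f f ` E)" "entourage Y dY (map_prod g g ` E)"
      using E f g unfolding coarse_map_def by blast+
    then have "entourage Y dY H"
      using assms(1,4) unfolding H_def close_maps_def
      by (intro entourage_Un entourage_relcomp)
    then have "coarsely_bounded Y dY (thickening H A \<inter> thickening H B)"
      using disj unfolding coarsely_disjoint_def by blast
    \<comment> \<open>Both memberships concern the point \<open>f x\<close>, so it suffices to pull
      back along \<open>f\<close>, under which preimages of bounded sets are bounded.\<close>
    then have bdd: "coarsely_bounded X dX (f -` (thickening H A \<inter> thickening H B) \<inter> X)"
      using f unfolding coarse_map_def by blast
    have "x \<in> f -` (thickening H A \<inter> thickening H B) \<inter> X"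
      if "(x, a) \<in> E" "f a \<in> A" "(x, b) \<in> E" "g b \<in> B" for x a b
    proof -
      have x: "x \<in> X"
        using E that(1) unfolding entourage_def by blast
      have "(f x, f a) \<in> H"
        unfolding H_def using that(1) by force
      moreover have "(f x, g b) \<in> H"
        unfolding H_def
      proof (intro UnI2 relcompI)
        show "(f x, g x) \<in> (\<lambda>x. (f x, g x)) ` X"
          using x by (rule imageI)
        show "(g x, g b) \<in> map_prod g g ` E"
          using that(3) by force
      qed
      ultimately show ?thesis
        using that(2,4) x by (auto simp: thickening_def)
    qed
    then show ?thesis
      by (intro coarsely_bounded_subset[OF bdd]) (auto simp: thickening_def)
  qed
  then show False
    using close unfolding close_sets_def coarsely_disjoint_def by blast
qed

text \<open>Members of the two push-forwards have preimages in \<open>F\<close> and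
  \<open>G\<close>; these are close, and closeness passes from the preimages to the sets in
  \<open>Y\<close>.\<close>

lemma asymptotically_alike_pushforward:
  assumes "Metric_space Y dY"
    and "coarse_map X dX Y dY f" "coarse_map X dX Y dY g"
    and "close_maps X Y dY f g"
    and "asymptotically_alike X dX F G"
  shows "asymptotically_alike Y dY (pushforward X Y f F) (pushforward X Y g G)"
  using close_sets_vimage[OF assms(1-4)] assms(5)
  unfolding asymptotically_alike_def pushforward_def by blast

lemma coarse_ultrafilter_pushforward:
  assumes "Metric_space Y dY" and f: "coarse_map X dX Y dY f"
    and F: "coarse_ultrafilter X dX F"
  shows "coarse_ultrafilter Y dY (pushforward X Y f F)"
proof -
  have fXY: "f \<in> X \<rightarrow> Y"
    using f unfolding coarse_map_def by blast
  \<comment> \<open>The first ultrafilter axiom says precisely that \<open>F\<close> is alike to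
    itself, so it is inherited through the case \<open>f = g\<close>.\<close>
  have "asymptotically_alike X dX F F"
    using F unfolding coarse_ultrafilter_def asymptotically_alike_def by blast
  then have "asymptotically_alike Y dY (pushforward X Y f F) (pushforward X Y f F)"
    by (rule asymptotically_alike_pushforward[OF assms(1) f f close_maps_refl[OF assms(1) fXY]])
  moreover have "f -` Y \<inter> X = X"
    using fXY by auto
  \<comment> \<open>The union axiom carries over because preimages commute with unions.\<close>
  moreover have "f -` A \<inter> X \<in> F \<or> f -` B \<inter> X \<in> F" if "f -` (A \<union> B) \<inter> X \<in> F" for A B
  proof -
    have "f -` (A \<union> B) \<inter> X = (f -` A \<inter> X) \<union> (f -` B \<inter> X)"
      by blast
    then show ?thesis
      using that F unfolding coarse_ultrafilter_def by simp
  qed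
  ultimately show ?thesis
    using F unfolding coarse_ultrafilter_def asymptotically_alike_def pushforward_def by auto
qed

theorem lemma20:
  fixes X :: "'a set" and dX :: "'a \<Rightarrow> 'a \<Rightarrow> real"
    and Y :: "'b set" and dY :: "'b \<Rightarrow> 'b \<Rightarrow> real"
    and f g :: "'a \<Rightarrow> 'b" and F G :: "'a set set"
  assumes "Metric_space X dX" and "Metric_space Y dY"
    and "coarse_map X dX Y dY f" and "coarse_map X dX Y dY g"
    and "close_maps X Y dY f g"
    and "coarse_ultrafilter X dX F" and "coarse_ultrafilter X dX G"
    and "asymptotically_alike X dX F G"
  shows "coarse_ultrafilter Y dY (pushforward X Y f F) \<and>
    coarse_ultrafilter Y dY (pushforward X Y g G) \<and>
    asymptotically_alike Y dY (pushforward X Y f F) (pushforward X Y g G)"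
  using coarse_ultrafilter_pushforward[OF assms(2,3,6)] coarse_ultrafilter_pushforward[OF assms(2,4,7)]
    asymptotically_alike_pushforward[OF assms(2-5,8)]
  by (intro conjI)

end
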